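(* Let $f:\mathbb{R}^n\to\overline{\mathbb{R}}$ be proper and lower semicontinuous, let $\bar x\in\operatorname{dom} f$ and $\bar v\in\partial f(\bar x)$. Then $f$ is variationally convex at $\bar x$ for $\bar v\in\partial f(\bar x)$ if and only if its epigraph $\operatorname{epi} f$ is variationally convex (as a closed set in $\mathbb{R}^n\times\mathbb{R}$) at $(\bar x,f(\bar x))$ for $(\bar v,-1)\in N_{\operatorname{epi} f}(\bar x,f(\bar x))$.
   Context: $\overline{\mathbb{R}}=[-\infty,+\infty]$; $f$ is proper if $f>-\infty$ and $f\not\equiv+\infty$; $\operatorname{dom} f=\{x: f(x)<+\infty\}$; $\operatorname{epi} f=\{(x,\alpha)\in\mathbb{R}^n\times\mathbb{R}: f(x)\le\alpha\}$. Limiting (Mordukhovich) subdifferential: for $\bar x\in\operatorname{dom}f$, the regular subdifferential is $\widehat\partial f(\bar x)=\{v:\liminf_{x\to\bar x,\,x\ne\bar x}\frac{f(x)-f(\bar x)-\langle v,x-\bar x\rangle}{\|x-\bar x\|}\ge0\}$, and $\partial f(\bar x)$ is the set of limits $v=\lim v_k$ with $v_k\in\widehat\partial f(x_k)$, $x_k\to\bar x$, $f(x_k)\to f(\bar x)$; $\partial f(x)=\emptyset$ for $x\notin\operatorname{dom}f$. For a closed set $C$, $N_C=\partial\delta_C$ is the limiting normal cone mapping, where $\delta_C$ is the indicator function ($0$ on $C$, $+\infty$ off $C$). $\operatorname{gph}T=\{(x,v): v\in T(x)\}$. Variational convexity of a function: a proper lsc $f$ is variationally convex at $\bar x\in\operatorname{dom}f$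 for $\bar v\in\partial f(\bar x)$ if there exist open convex neighborhoods $U$ of $\bar x$ and $V$ of $\bar v$, a convex lsc function $\hat f:\mathbb{R}^n\to\overline{\mathbb{R}}$ with $\hat f\le f$ on $U$, and $\varepsilon>0$ such that $[U_\varepsilon\times V]\cap\operatorname{gph}\partial f=[U\times V]\cap\operatorname{gph}\partial\hat f$, where $U_\varepsilon=\{x\in U: f(x)<f(\bar x)+\varepsilon\}$, and moreover $f(x)=\hat f(x)$ for every $(x,v)$ in this common graph. Variational convexity of a set: a nonempty closed set $C$ is variationally convex at $\bar x\in C$ for $\bar v\in N_C(\bar x)$ if there exist open convex neighborhoods $U\ni\bar x$ and $V\ni\bar v$ such that for every $(x,v)\in\operatorname{gph}N_C\cap[U\times V]$ one has $\langle v,x'-x\rangle\le0$ for all $x'\in C\cap U$. *)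

theory Defs
  imports "HOL-Analysis.Analysis"
begin

definition proper :: "('a \<Rightarrow> ereal) \<Rightarrow> bool" where
  "proper f \<longleftrightarrow> (\<forall>x. f x > -\<infinity>) \<and> (\<exists>x. f x \<noteq> \<infinity>)"

definition effective_domain :: "('a \<Rightarrow> ereal) \<Rightarrow> 'a set" where
  "effective_domain f = {x. f x < \<infinity>}"

definition epi :: "('a \<Rightarrow> ereal) \<Rightarrow> ('a \<times> real) set" where
  "epi f = {(x, \<alpha>). f x \<le> ereal \<alpha>}"

definition lsc :: "('a::topological_space \<Rightarrow> ereal) \<Rightarrow> bool" where
  "lsc f \<longleftrightarrow> (\<forall>x. f x \<le> Liminf (at x) f)"

text \<open>Convexity of an extended-real-valued function is convexity of its epigraph, which needs no
  convention for sums of opposite infinities.\<close>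

definition convex_fun :: "('a::real_vector \<Rightarrow> ereal) \<Rightarrow> bool" where
  "convex_fun f \<longleftrightarrow> convex (epi f)"

text \<open>For improper \<open>f\<close> with \<open>f x = -\<infinity>\<close>, the \<open>ereal\<close> convention
  \<open>(-\<infinity>) - (-\<infinity>) = \<infinity>\<close> makes every vector a regular subgradient at \<open>x\<close>, as for the
  convex subdifferential. For proper functions this case does not arise.\<close>

definition regular_subdifferential ::
    "('a::euclidean_space \<Rightarrow> ereal) \<Rightarrow> 'a \<Rightarrow> 'a set" where
  "regular_subdifferential f x = {v. x \<in> effective_domain f \<and>
     0 \<le> Liminf (at x) (\<lambda>y. (f y - f x - ereal (v \<bullet> (y - x))) / ereal (norm (y - x)))}"

definition limiting_subdifferential ::
    "('a::euclidean_space \<Rightarrow> ereal) \<Rightarrow> 'a \<Rightarrow> 'a set" where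
  "limiting_subdifferential f x = {v. x \<in> effective_domain f \<and>
     (\<exists>(xs :: nat \<Rightarrow> 'a) (vs :: nat \<Rightarrow> 'a).
        (\<forall>k. vs k \<in> regular_subdifferential f (xs k)) \<and>
        xs \<longlonglongrightarrow> x \<and> (\<lambda>k. f (xs k)) \<longlonglongrightarrow> f x \<and> vs \<longlonglongrightarrow> v)}"

definition indicator_fun :: "'a set \<Rightarrow> 'a \<Rightarrow> ereal" where
  "indicator_fun C x = (if x \<in> C then 0 else \<infinity>)"

definition limiting_normal_cone :: "'a::euclidean_space set \<Rightarrow> 'a \<Rightarrow> 'a set" where
  "limiting_normal_cone C = limiting_subdifferential (indicator_fun C)"

definition gph :: "('a \<Rightarrow> 'b set) \<Rightarrow> ('a \<times> 'b) set" where
  "gph T = {(x, v). v \<in> T x}"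

text \<open>The standing requirements under which the two notions of variational convexity are defined
  (properness and lower semicontinuity, respectively closedness, and membership of the reference pair in
  the graph) are part of the predicates.\<close>

definition variationally_convex_fun ::
    "('a::euclidean_space \<Rightarrow> ereal) \<Rightarrow> 'a \<Rightarrow> 'a \<Rightarrow> bool" where
  "variationally_convex_fun f xbar vbar \<longleftrightarrow>
     proper f \<and> lsc f \<and> xbar \<in> effective_domain f \<and> vbar \<in> limiting_subdifferential f xbar \<and>
     (\<exists>U V fhat. \<exists>\<epsilon>>0.
        open U \<and> convex U \<and> xbar \<in> U \<and> open V \<and> convex V \<and> vbar \<in> V \<and>
        convex_fun fhat \<and> lsc fhat \<and> (\<forall>x\<in>U. fhat x \<le> f x) \<and>
        ({x \<in> U. f x < f xbar + ereal \<epsilon>} \<times> V) \<inter> gph (limiting_subdifferential f)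
          = (U \<times> V) \<inter> gph (limiting_subdifferential fhat) \<and>
        (\<forall>(x, v) \<in> (U \<times> V) \<inter> gph (limiting_subdifferential fhat). f x = fhat x))"

definition variationally_convex_set ::
    "'a::euclidean_space set \<Rightarrow> 'a \<Rightarrow> 'a \<Rightarrow> bool" where
  "variationally_convex_set C xbar vbar \<longleftrightarrow>
     C \<noteq> {} \<and> closed C \<and> xbar \<in> C \<and> vbar \<in> limiting_normal_cone C xbar \<and>
     (\<exists>U V. open U \<and> convex U \<and> xbar \<in> U \<and> open V \<and> convex V \<and> vbar \<in> V \<and>
        (\<forall>(x, v) \<in> gph (limiting_normal_cone C) \<inter> (U \<times> V). \<forall>x' \<in> C \<inter> U. v \<bullet> (x' - x) \<le> 0))"

end

theory Submission
  imports Defs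
begin

text \<open>
  Both notions say that, near the reference pair, every subgradient \<open>v\<close> of \<open>f\<close> at \<open>x\<close> yields an affine
  minorant \<open>f x + v \<bullet> (y - x)\<close> of \<open>f\<close> on a neighbourhood. For the function this follows from the convex
  minorant; conversely the supremum \<open>fh\<close> of all these affine minorants is convex, lies below \<open>f\<close>, and has
  the localized subgradients of \<open>f\<close> among its own. To see that it has no others, take a subgradient \<open>w\<close>
  of \<open>fh\<close> at \<open>z\<close> and minimize \<open>f y - w \<bullet> y + (norm (y - z))\<^sup>2 / 2\<close> near the reference point. The
  minimizer \<open>x\<close> has the subgradient \<open>w + z - x\<close>, which is then also one of \<open>fh\<close>, and monotonicity of the
  subdifferential of \<open>fh\<close> forces \<open>x = z\<close>.
\<close>

section \<open>Regular subgradients and normals as local estimates\<close>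

text \<open>Clearing the denominator turns the \<open>Liminf\<close> into an estimate without
  quotients, the form used from here on. At \<open>y = x\<close> the estimate is trivial, so the
  punctured filter can be replaced by \<open>nhds x\<close>; the strict inequality is recovered by
  passing to \<open>e/2\<close>.\<close>

lemma regular_subdifferential_iff:
  fixes g :: "'a::euclidean_space \<Rightarrow> ereal"
  assumes gx: "g x = ereal c"
  shows "v \<in> regular_subdifferential g x \<longleftrightarrow>
    (\<forall>e>0. \<forall>\<^sub>F y in nhds x. ereal (c + v \<bullet> (y - x) - e * norm (y - x)) \<le> g y)"
proof -
  let ?q = "\<lambda>y. (g y - g x - ereal (v \<bullet> (y - x))) / ereal (norm (y - x))"
  have less: "ereal (- e) < ?q y \<longleftrightarrow> ereal (c + v \<bullet> (y - x) - e * norm (y - x)) < g y"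
    if "y \<noteq> x" for e y
    using that by (cases "g y") (auto simp: gx field_simps)
  have "v \<in> regular_subdifferential g x \<longleftrightarrow> (\<forall>b<0. \<forall>\<^sub>F y in at x. b < ?q y)"
    by (simp add: regular_subdifferential_def effective_domain_def gx le_Liminf_iff)
  also have "\<dots> \<longleftrightarrow> (\<forall>e>0. \<forall>\<^sub>F y in at x. ereal (- e) < ?q y)"
  proof (intro iffI allI impI)
    fix e :: real assume "\<forall>b<0. \<forall>\<^sub>F y in at x. b < ?q y" "e > 0"
    then show "\<forall>\<^sub>F y in at x. ereal (- e) < ?q y" by auto
  next
    fix b :: ereal assume H: "\<forall>e>0. \<forall>\<^sub>F y in at x. ereal (- e) < ?q y" and "b < 0"
    then obtain r where r: "b < ereal r" "ereal r < 0"
      using ereal_dense2 by blast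
    then have "\<forall>\<^sub>F y in at x. ereal (- (- r)) < ?q y"
      using H[rule_format, of "- r"] by simp
    then show "\<forall>\<^sub>F y in at x. b < ?q y"
      by eventually_elim (use r in auto)
  qed
  also have "\<dots> \<longleftrightarrow> (\<forall>e>0. \<forall>\<^sub>F y in at x. ereal (c + v \<bullet> (y - x) - e * norm (y - x)) < g y)"
    by (intro all_cong eventually_cong refl) (auto simp: eventually_at_filter less)
  also have "\<dots> \<longleftrightarrow> (\<forall>e>0. \<forall>\<^sub>F y in nhds x. ereal (c + v \<bullet> (y - x) - e * norm (y - x)) \<le> g y)"
  proof (intro iffI allI impI)
    fix e :: real
    assume H: "\<forall>e>0. \<forall>\<^sub>F y in at x. ereal (c + v \<bullet> (y - x) - e * norm (y - x)) < g y" and "e > 0"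
    then have "\<forall>\<^sub>F y in at x. ereal (c + v \<bullet> (y - x) - e * norm (y - x)) < g y" by blast
    then show "\<forall>\<^sub>F y in nhds x. ereal (c + v \<bullet> (y - x) - e * norm (y - x)) \<le> g y"
      unfolding eventually_at_filter
    proof eventually_elim
      case (elim y)
      then show ?case by (cases "y = x") (auto simp: gx less_imp_le)
    qed
  next
    fix e :: real
    assume H: "\<forall>e>0. \<forall>\<^sub>F y in nhds x. ereal (c + v \<bullet> (y - x) - e * norm (y - x)) \<le> g y" and "e > 0"
    then have "\<forall>\<^sub>F y in nhds x. ereal (c + v \<bullet> (y - x) - (e/2) * norm (y - x)) \<le> g y"
      using half_gt_zero by blast
    then show "\<forall>\<^sub>F y in at x. ereal (c + v \<bullet> (y - x) - e * norm (y - x)) < g y"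
      unfolding eventually_at_filter
    proof eventually_elim
      case (elim y)
      have "ereal (c + v \<bullet> (y - x) - e * norm (y - x)) < ereal (c + v \<bullet> (y - x) - (e/2) * norm (y - x))"
        if "y \<noteq> x"
        using \<open>e > 0\<close> that by simp
      with elim show ?case by (blast intro: less_le_trans)
    qed
  qed
  finally show ?thesis .
qed

definition regular_normal_cone :: "'a::euclidean_space set \<Rightarrow> 'a \<Rightarrow> 'a set" where
  "regular_normal_cone C = regular_subdifferential (indicator_fun C)"

lemma regular_normal_cone_iff:
  "v \<in> regular_normal_cone C x \<longleftrightarrow>
    x \<in> C \<and> (\<forall>e>0. \<forall>\<^sub>F y in nhds x. y \<in> C \<longrightarrow> v \<bullet> (y - x) \<le> e * norm (y - x))"
proof (cases "x \<in> C")
  case True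
  then have "indicator_fun C x = ereal 0" by (simp add: indicator_fun_def)
  from regular_subdifferential_iff[of "indicator_fun C", OF this] True show ?thesis
    by (auto simp: regular_normal_cone_def indicator_fun_def zero_ereal_def intro!: all_cong eventually_cong)
next
  case False
  then show ?thesis
    by (simp add: regular_normal_cone_def regular_subdifferential_def effective_domain_def indicator_fun_def)
qed

text \<open>Convergence of the function values is automatic, since the indicator is \<open>0\<close>
  at every point that has a regular normal.\<close>

lemma limiting_normal_cone_iff:
  "v \<in> limiting_normal_cone C x \<longleftrightarrow>
    x \<in> C \<and> (\<exists>xs vs. (\<forall>k::nat. vs k \<in> regular_normal_cone C (xs k)) \<and> xs \<longlonglongrightarrow> x \<and> vs \<longlonglongrightarrow> v)"
proof -
  have "(\<lambda>k. indicator_fun C (xs k)) \<longlonglongrightarrow> indicator_fun C x"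
    if "x \<in> C" "\<forall>k::nat. vs k \<in> regular_normal_cone C (xs k)" for xs vs
    using that by (simp add: regular_normal_cone_iff indicator_fun_def)
  then show ?thesis
    unfolding limiting_normal_cone_def limiting_subdifferential_def regular_normal_cone_def
    by (auto simp: effective_domain_def indicator_fun_def split: if_splits)
qed

section \<open>Subgradients as normals to the epigraph\<close>

text \<open>A point of the epigraph over \<open>y\<close> has height at least \<open>f y\<close>, so
  the local estimate for \<open>f\<close> bounds the inner product by
  \<open>e * norm (y - x)\<close>, which is at most \<open>e\<close> times the norm of the
  pair.\<close>

lemma regular_normal_epi:
  fixes f :: "'a::euclidean_space \<Rightarrow> ereal"
  assumes fx: "f x = ereal c" and v: "v \<in> regular_subdifferential f x"
  shows "(v, -1) \<in> regular_normal_cone (epi f) (x, c)"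
  unfolding regular_normal_cone_iff
proof (intro conjI allI impI)
  show "(x, c) \<in> epi f" by (simp add: epi_def fx)
  fix e :: real assume "e > 0"
  then have "\<forall>\<^sub>F y in nhds x. ereal (c + v \<bullet> (y - x) - e * norm (y - x)) \<le> f y"
    using v regular_subdifferential_iff[of f, OF fx] by blast
  then have "\<forall>\<^sub>F p in nhds (x, c). ereal (c + v \<bullet> (fst p - x) - e * norm (fst p - x)) \<le> f (fst p)"
    by (rule eventually_compose_filterlim) (simp add: nhds_prod filterlim_fst)
  then show "\<forall>\<^sub>F p in nhds (x, c). p \<in> epi f \<longrightarrow> (v, -1) \<bullet> (p - (x, c)) \<le> e * norm (p - (x, c))"
  proof eventually_elim
    case (elim p)
    obtain y b where p: "p = (y, b)" by (cases p)
    show ?case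
    proof
      assume "p \<in> epi f"
      then have "f y \<le> ereal b" by (simp add: p epi_def)
      with elim have "ereal (c + v \<bullet> (y - x) - e * norm (y - x)) \<le> ereal b"
        unfolding p fst_conv by (rule order_trans)
      moreover have "e * norm (y - x) \<le> e * norm (p - (x, c))"
        using \<open>e > 0\<close> by (intro mult_left_mono) (auto simp: p norm_Pair)
      ultimately show "(v, -1) \<bullet> (p - (x, c)) \<le> e * norm (p - (x, c))"
        by (simp add: p)
    qed
  qed
qed

text \<open>Strictly above the graph, vertical descent inside the epigraph would violate the normal
  inequality. On the graph, a point violating the subgradient estimate for the rescaled vector would
  give a nearby point of the epigraph violating the normal inequality.\<close>

lemma regular_normal_epi_cases:
  fixes f :: "'a::euclidean_space \<Rightarrow> ereal"
  assumes n: "(v, m) \<in> regular_normal_cone (epi f) (x, a)" and "m < 0"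
  shows "f x = ereal a" "(1 / - m) *\<^sub>R v \<in> regular_subdifferential f x"
proof -
  from n have epi: "f x \<le> ereal a" by (simp add: regular_normal_cone_iff epi_def)
  have n': "\<exists>d>0. \<forall>y b. dist (y, b) (x, a) < d \<longrightarrow> f y \<le> ereal b \<longrightarrow>
      v \<bullet> (y - x) + m * (b - a) \<le> e * norm (y - x, b - a)" if "e > 0" for e
    using n that by (simp add: regular_normal_cone_iff epi_def eventually_nhds_metric)
  show fx: "f x = ereal a"
  proof (rule ccontr)
    assume "f x \<noteq> ereal a"
    with epi have "f x < ereal a" by simp
    then obtain b where b: "f x < ereal b" "b < a"
      by (metis ereal_dense2 ereal_less_eq(3) less_ereal.simps(1))
    \<comment> \<open>A descent by \<open>t\<close> makes the left-hand side \<open>- m * t\<close>;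
      the tolerance \<open>- m / 2\<close> permits only half of it.\<close>
    obtain d where d: "d > 0" "\<And>y b. dist (y, b) (x, a) < d \<Longrightarrow> f y \<le> ereal b \<Longrightarrow>
      v \<bullet> (y - x) + m * (b - a) \<le> (- m / 2) * norm (y - x, b - a)"
      using n'[of "- m / 2"] \<open>m < 0\<close> by auto
    \<comment> \<open>\<open>d / 2\<close> keeps the lowered point within distance \<open>d\<close>,
      and \<open>a - b\<close> keeps its height at or above \<open>b\<close>, hence the point in the
      epigraph.\<close>
    define t where "t = min (d / 2) (a - b)"
    have t: "t > 0" "t < d" "b \<le> a - t" using d b by (auto simp: t_def min_def)
    from t(3) b(1) have "f x \<le> ereal (a - t)"
      by (meson ereal_less_eq(3) less_imp_le order_trans)
    with d(2)[of x "a - t"] t have "m * (- t) \<le> (- m / 2) * t"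
      by (simp add: dist_norm norm_Pair)
    with \<open>m < 0\<close> t(1) show False by (simp add: field_simps mult_less_0_iff)
  qed
  define w where "w = (1 / - m) *\<^sub>R v"
  have v: "v = (- m) *\<^sub>R w" using \<open>m < 0\<close> by (simp add: w_def)
  have "\<forall>\<^sub>F y in nhds x. ereal (a + w \<bullet> (y - x) - e * norm (y - x)) \<le> f y" if "e > 0" for e
  proof -
    \<comment> \<open>\<open>K * norm (y - x)\<close> bounds the norm of
      \<open>(y - x, b - a)\<close> when \<open>b\<close> is the height of the estimate at
      \<open>y\<close>. The tolerance \<open>- m * e / (2 * K)\<close> then permits half of the
      amount \<open>- m * e * norm (y - x)\<close> that a violation produces.\<close>
    define K where "K = 1 + norm w + e"
    have K: "K > 0" using that by (simp add: K_def add_pos_nonneg add_nonneg_pos)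
    have "- m * e / (2 * K) > 0" using \<open>m < 0\<close> K that by (simp add: divide_neg_pos mult_neg_pos)
    from n'[OF this] obtain d where d: "d > 0" "\<And>y b. dist (y, b) (x, a) < d \<Longrightarrow> f y \<le> ereal b \<Longrightarrow>
      v \<bullet> (y - x) + m * (b - a) \<le> (- m * e / (2 * K)) * norm (y - x, b - a)"
      by blast
    have "ereal (a + w \<bullet> (y - x) - e * norm (y - x)) \<le> f y" if y: "dist y x < d / K" for y
    proof (rule ccontr)
      define b where "b = a + w \<bullet> (y - x) - e * norm (y - x)"
      assume "\<not> ereal (a + w \<bullet> (y - x) - e * norm (y - x)) \<le> f y"
      then have fb: "f y < ereal b" by (simp add: b_def)
      have ne: "y \<noteq> x" using fb fx by (auto simp: b_def)
      have "\<bar>b - a\<bar> \<le> \<bar>w \<bullet> (y - x)\<bar> + e * norm (y - x)"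
        using \<open>e > 0\<close> by (simp add: b_def) (smt (verit) mult_nonneg_nonneg norm_ge_zero)
      also have "\<dots> \<le> (norm w + e) * norm (y - x)"
        using Cauchy_Schwarz_ineq2[of w "y - x"] by (simp add: algebra_simps)
      finally have "norm (y - x, b - a) \<le> norm (y - x) + (norm w + e) * norm (y - x)"
        using norm_Pair_le[of "y - x" "b - a"] by simp
      then have N: "norm (y - x, b - a) \<le> K * norm (y - x)"
        by (simp add: K_def algebra_simps)
      also have "\<dots> < d" using y K by (simp add: dist_norm field_simps)
      finally have "dist (y, b) (x, a) < d" by (simp add: dist_norm)
      from d(2)[OF this] fb have "v \<bullet> (y - x) + m * (b - a) \<le> (- m * e / (2 * K)) * norm (y - x, b - a)"
        by simp
      also have "\<dots> \<le> (- m * e / (2 * K)) * (K * norm (y - x))"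
        using N \<open>m < 0\<close> K \<open>e > 0\<close> by (intro mult_left_mono) (auto simp: divide_nonpos_pos mult_nonpos_nonneg)
      also have "\<dots> = (- m * e / 2) * norm (y - x)"
        using K by simp
      also have "v \<bullet> (y - x) + m * (b - a) = (- m * e) * norm (y - x)"
        by (simp add: v b_def algebra_simps)
      finally show False using ne \<open>m < 0\<close> \<open>e > 0\<close>
        by (simp add: field_simps mult_less_0_iff)
    qed
    then show ?thesis unfolding eventually_nhds_metric using d(1) K by (meson divide_pos_pos)
  qed
  then show "(1 / - m) *\<^sub>R v \<in> regular_subdifferential f x"
    using regular_subdifferential_iff[of f, OF fx] by (simp add: w_def)
qed

text \<open>Convergence of the values \<open>f (xs k)\<close> is convergence of the heights of the
  graph points that carry the regular normals \<open>(vs k, -1)\<close>; properness makes these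
  values real.\<close>

lemma limiting_normal_epi:
  fixes f :: "'a::euclidean_space \<Rightarrow> ereal"
  assumes "proper f" and fx: "f x = ereal c" and v: "v \<in> limiting_subdifferential f x"
  shows "(v, -1) \<in> limiting_normal_cone (epi f) (x, c)"
proof -
  from v obtain xs vs where s: "\<And>k::nat. vs k \<in> regular_subdifferential f (xs k)"
      "xs \<longlonglongrightarrow> x" "(\<lambda>k. f (xs k)) \<longlonglongrightarrow> f x" "vs \<longlonglongrightarrow> v"
    by (auto simp: limiting_subdifferential_def)
  have fin: "f (xs k) = ereal (real_of_ereal (f (xs k)))" for k
    using s(1)[of k] \<open>proper f\<close>
    by (cases "f (xs k)") (auto simp: regular_subdifferential_def effective_domain_def proper_def)
  have "(\<lambda>k. (xs k, real_of_ereal (f (xs k)))) \<longlonglongrightarrow> (x, c)"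
    using s(2,3) unfolding fx by (intro tendsto_Pair lim_real_of_ereal)
  moreover have "(\<lambda>k. (vs k, -1::real)) \<longlonglongrightarrow> (v, -1)"
    using s(4) by (intro tendsto_Pair tendsto_const)
  moreover have "(vs k, -1) \<in> regular_normal_cone (epi f) (xs k, real_of_ereal (f (xs k)))" for k
    using regular_normal_epi[OF fin s(1)] .
  moreover have "(x, c) \<in> epi f" by (simp add: epi_def fx)
  ultimately show ?thesis
    unfolding limiting_normal_cone_iff
    by (intro conjI exI[of _ "\<lambda>k. (xs k, real_of_ereal (f (xs k)))"] exI[of _ "\<lambda>k. (vs k, -1)"]) auto
qed

lemma regular_subset_limiting: "regular_subdifferential f x \<subseteq> limiting_subdifferential f x"
proof
  fix v assume "v \<in> regular_subdifferential f x"
  then show "v \<in> limiting_subdifferential f x"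
    unfolding limiting_subdifferential_def
    by (intro CollectI conjI exI[of _ "\<lambda>_. x"] exI[of _ "\<lambda>_. v"])
       (auto simp: regular_subdifferential_def)
qed

section \<open>Lower semicontinuous and convex functions\<close>

lemma lsc_eventually:
  assumes "lsc f" "b < f x"
  shows "\<forall>\<^sub>F y in nhds x. b < f y"
  using assms by (auto simp: lsc_def le_Liminf_iff eventually_nhds_conv_at)

lemma closed_epi:
  assumes "lsc f"
  shows "closed (epi f)"
proof -
  have "\<forall>\<^sub>F p in nhds (x, a). p \<in> - epi f" if "(x, a) \<notin> epi f" for x a
  proof -
    from that have "ereal a < f x" by (simp add: epi_def)
    then obtain b where b: "ereal a < ereal b" "ereal b < f x" using ereal_dense2 by blast
    have "\<forall>\<^sub>F y in nhds x. ereal b < f y" by (rule lsc_eventually[OF assms b(2)])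
    moreover have "\<forall>\<^sub>F c in nhds a. c < b"
      using b(1) eventually_nhds_in_open[of "{..<b}" a] by simp
    ultimately have "\<forall>\<^sub>F p in nhds x \<times>\<^sub>F nhds a. ereal b < f (fst p) \<and> snd p < b"
      by (intro eventually_conj eventually_compose_filterlim[OF _ filterlim_fst]
          eventually_compose_filterlim[OF _ filterlim_snd])
    then show ?thesis unfolding nhds_prod
    proof eventually_elim
      case (elim p)
      then have "ereal (snd p) < f (fst p)" by (metis less_ereal.simps(1) less_trans)
      then show ?case by (cases p) (simp add: epi_def)
    qed
  qed
  then show ?thesis
    unfolding closed_def
    by (subst open_subopen) (force simp: eventually_nhds)
qed

text \<open>A value \<open>-\<infinity>\<close> would by convexity pull \<open>g\<close> down to at
  most \<open>c - 1\<close> at points arbitrarily close to \<open>x\<close>, against lower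
  semicontinuity. This is for the convex function \<open>fhat\<close> of the definition, which is
  not assumed proper.\<close>

lemma convex_lsc_not_MInf:
  fixes g :: "'a::euclidean_space \<Rightarrow> ereal"
  assumes "convex_fun g" "lsc g" and gx: "g x = ereal c"
  shows "g y \<noteq> -\<infinity>"
proof
  assume gy: "g y = -\<infinity>"
  have cv: "convex (epi g)" using assms(1) by (simp add: convex_fun_def)
  \<comment> \<open>\<open>c - 1 / t\<close> is the height at \<open>y\<close> for which the convex combination has height \<open>c - 1\<close>.\<close>
  have low: "g (x + t *\<^sub>R (y - x)) \<le> ereal (c - 1)" if t: "0 < t" "t \<le> 1" for t
  proof -
    have "(x, c) \<in> epi g" "(y, c - 1 / t) \<in> epi g" by (auto simp: epi_def gx gy)
    from convexD_alt[OF cv this, of t] t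
    have "((1 - t) *\<^sub>R x + t *\<^sub>R y, (1 - t) * c + t * (c - 1 / t)) \<in> epi g" by simp
    moreover have "(1 - t) *\<^sub>R x + t *\<^sub>R y = x + t *\<^sub>R (y - x)" by (simp add: algebra_simps)
    moreover have "(1 - t) * c + t * (c - 1 / t) = c - 1" using t by (simp add: field_simps)
    ultimately show ?thesis by (simp add: epi_def)
  qed
  have "\<forall>\<^sub>F z in nhds x. ereal (c - 1) < g z" by (rule lsc_eventually[OF assms(2)]) (simp add: gx)
  moreover have "((\<lambda>t. x + t *\<^sub>R (y - x)) \<longlongrightarrow> x) (at_right 0)"
    by (auto intro!: tendsto_eq_intros)
  ultimately have "\<forall>\<^sub>F t in at_right 0. ereal (c - 1) < g (x + t *\<^sub>R (y - x))"
    by (rule eventually_compose_filterlim)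
  moreover have "\<forall>\<^sub>F t::real in at_right 0. 0 < t \<and> t < 1"
    using eventually_at_right_real[of 0 1] by simp
  ultimately have "\<forall>\<^sub>F t::real in at_right 0. False"
    by eventually_elim (use low in force)
  then show False by simp
qed

text \<open>Convexity carries the local estimate along the segment to \<open>y\<close>: a gap
  \<open>s\<close> at \<open>y\<close> becomes a gap of at least \<open>t * s\<close> at the
  fraction \<open>t\<close>, while the estimate permits only
  \<open>t * e * norm (y - x)\<close>.\<close>

lemma convex_regular_subgradient:
  fixes g :: "'a::euclidean_space \<Rightarrow> ereal"
  assumes "convex_fun g" and gx: "g x = ereal c" and v: "v \<in> regular_subdifferential g x"
  shows "ereal (c + v \<bullet> (y - x)) \<le> g y"
proof (rule ccontr)
  assume "\<not> ?thesis"
  then have "g y < ereal (c + v \<bullet> (y - x))" by simp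
  \<comment> \<open>A real \<open>b\<close> stands in for \<open>g y\<close>, which may be
    \<open>-\<infinity>\<close>, so that \<open>(y, b)\<close> is a point of the epigraph.\<close>
  then obtain b where b: "g y < ereal b" "b < c + v \<bullet> (y - x)"
    by (metis ereal_dense2 less_ereal.simps(1))
  define s where "s = c + v \<bullet> (y - x) - b"
  \<comment> \<open>Chosen so that \<open>e * (norm (y - x) + 1) = s / 2\<close>; the added
    \<open>1\<close> covers \<open>y = x\<close>.\<close>
  define e where "e = s / (2 * (norm (y - x) + 1))"
  have s: "s > 0" using b by (simp add: s_def)
  have e: "e > 0" using s by (simp add: e_def add_nonneg_pos)
  have es: "e * norm (y - x) < s"
  proof -
    have "e * norm (y - x) \<le> e * (norm (y - x) + 1)" using e by simp
    also have "\<dots> = s / 2" by (simp add: e_def field_simps add_nonneg_eq_0_iff)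
    finally show ?thesis using s by simp
  qed
  have cv: "convex (epi g)" using assms(1) by (simp add: convex_fun_def)
  have up: "g (x + t *\<^sub>R (y - x)) \<le> ereal (c + t * (b - c))" if t: "0 < t" "t \<le> 1" for t
  proof -
    have "(x, c) \<in> epi g" "(y, b) \<in> epi g" using b by (auto simp: epi_def gx)
    from convexD_alt[OF cv this, of t] t
    have "((1 - t) *\<^sub>R x + t *\<^sub>R y, (1 - t) * c + t * b) \<in> epi g" by simp
    then show ?thesis by (simp add: epi_def algebra_simps)
  qed
  have "\<forall>\<^sub>F z in nhds x. ereal (c + v \<bullet> (z - x) - e * norm (z - x)) \<le> g z"
    using v e regular_subdifferential_iff[of g, OF gx] by blast
  moreover have "((\<lambda>t. x + t *\<^sub>R (y - x)) \<longlongrightarrow> x) (at_right 0)"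
    by (auto intro!: tendsto_eq_intros)
  ultimately have "\<forall>\<^sub>F t in at_right 0. ereal (c + v \<bullet> (x + t *\<^sub>R (y - x) - x)
      - e * norm (x + t *\<^sub>R (y - x) - x)) \<le> g (x + t *\<^sub>R (y - x))"
    by (rule eventually_compose_filterlim)
  moreover have "\<forall>\<^sub>F t::real in at_right 0. 0 < t \<and> t < 1"
    using eventually_at_right_real[of 0 1] by simp
  ultimately have "\<forall>\<^sub>F t::real in at_right 0. False"
  proof eventually_elim
    case (elim t)
    then have "g (x + t *\<^sub>R (y - x)) \<le> ereal (c + t * (b - c))" by (intro up) auto
    with elim(1) have "ereal (c + v \<bullet> (x + t *\<^sub>R (y - x) - x) - e * norm (x + t *\<^sub>R (y - x) - x))
        \<le> ereal (c + t * (b - c))"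
      by (rule order_trans)
    then have "c + t * (v \<bullet> (y - x)) - e * (t * norm (y - x)) \<le> c + t * (b - c)"
      using elim by simp
    then have "t * s \<le> t * (e * norm (y - x))"
      by (simp add: s_def algebra_simps)
    with elim es show ?case by simp
  qed
  then show False by simp
qed

text \<open>The affine minorants based at \<open>xs k\<close> converge pointwise, and the weak
  inequality survives the limit.\<close>

lemma convex_limiting_subgradient:
  fixes g :: "'a::euclidean_space \<Rightarrow> ereal"
  assumes "convex_fun g" and gm: "\<And>y. g y \<noteq> -\<infinity>" and gx: "g x = ereal c"
    and v: "v \<in> limiting_subdifferential g x"
  shows "ereal (c + v \<bullet> (y - x)) \<le> g y"
proof -
  from v obtain xs vs where s: "\<And>k::nat. vs k \<in> regular_subdifferential g (xs k)"
      "xs \<longlonglongrightarrow> x" "(\<lambda>k. g (xs k)) \<longlonglongrightarrow> g x" "vs \<longlonglongrightarrow> v"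
    by (auto simp: limiting_subdifferential_def)
  have fin: "g (xs k) = ereal (real_of_ereal (g (xs k)))" for k
    using s(1)[of k] gm[of "xs k"]
    by (cases "g (xs k)") (auto simp: regular_subdifferential_def effective_domain_def)
  have "(\<lambda>k. real_of_ereal (g (xs k))) \<longlonglongrightarrow> c"
    using s(3) unfolding gx by (rule lim_real_of_ereal)
  then have "(\<lambda>k. ereal (real_of_ereal (g (xs k)) + vs k \<bullet> (y - xs k))) \<longlonglongrightarrow> ereal (c + v \<bullet> (y - x))"
    by (intro tendsto_ereal tendsto_add tendsto_inner tendsto_diff tendsto_const s)
  then show ?thesis
    by (rule LIMSEQ_le_const2)
      (use convex_regular_subgradient[OF assms(1) fin s(1)] in blast)
qed

lemma global_subgradient_regular:
  fixes g :: "'a::euclidean_space \<Rightarrow> ereal"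
  assumes gx: "g x = ereal c" and H: "\<And>y. ereal (c + v \<bullet> (y - x)) \<le> g y"
  shows "v \<in> regular_subdifferential g x"
  unfolding regular_subdifferential_iff[of g, OF gx]
proof (intro allI impI always_eventually)
  fix e :: real and y assume "e > 0"
  then have "ereal (c + v \<bullet> (y - x) - e * norm (y - x)) \<le> ereal (c + v \<bullet> (y - x))" by simp
  then show "ereal (c + v \<bullet> (y - x) - e * norm (y - x)) \<le> g y" using H order_trans by blast
qed

section \<open>Minimization with a quadratic penalty\<close>

text \<open>Expansion of the penalty about \<open>x\<close>: its linear part is the shift
  \<open>z - x\<close> by which the subgradient at a minimizer differs from
  \<open>w\<close>.\<close>

lemma half_sq_diff:
  fixes x y z :: "'a::real_inner"
  shows "(norm (x - z))\<^sup>2 / 2 - (norm (y - z))\<^sup>2 / 2 = (z - x) \<bullet> (y - x) - (norm (y - x))\<^sup>2 / 2"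
  by (simp add: power2_norm_eq_inner field_simps inner_diff_left inner_diff_right inner_commute)

text \<open>Comparison with \<open>x0\<close> places a minimizer of
  \<open>f y - w \<bullet> y\<close> plus the penalty in the interior of the ball, where minimality
  yields the subgradient up to a quadratic error. The minimum is taken over a compact piece of the
  epigraph, on which the objective is continuous although \<open>f\<close> is only lower
  semicontinuous.\<close>

lemma perturbed_minimizer:
  fixes f :: "'a::euclidean_space \<Rightarrow> ereal"
  assumes "lsc f" and f0: "f x0 = ereal c0" and "r > 0"
    and low: "\<And>y. y \<in> cball x0 r \<Longrightarrow> ereal (c0 + v0 \<bullet> (y - x0)) \<le> f y"
    and w: "norm (w - v0) < d" and z: "norm (z - x0) < d" and d: "4 * d \<le> r"
  obtains x c where "f x = ereal c" "norm (x - x0) < 4 * d" "c \<le> c0 + (norm w + d) * (4 * d)"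
    "w + z - x \<in> regular_subdifferential f x"
proof -
  define g where "g = (\<lambda>(y, b::real). b - w \<bullet> y + (norm (y - z))\<^sup>2 / 2)"
  \<comment> \<open>\<open>M\<close> and \<open>m\<close> truncate the heights without affecting the
    minimum: above \<open>M\<close> the objective is no smaller than at \<open>(x0, c0)\<close>, and
    no point of the epigraph over the ball lies below \<open>m\<close>.\<close>
  define M where "M = c0 + (norm w + d) * r"
  define m where "m = c0 - norm v0 * r"
  define S where "S = epi f \<inter> (cball x0 r \<times> {m..M})"
  have dpos: "d > 0" using w norm_ge_zero le_less_trans by blast
  have gdiff: "g (x, a) - g (y, b) = a - b + (w + z - x) \<bullet> (y - x) - (norm (y - x))\<^sup>2 / 2" for x y a b
    using half_sq_diff[of x z y] by (simp add: g_def algebra_simps)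
  have slope: "(w + z - x0) \<bullet> (y - x0) \<le> (norm w + d) * norm (y - x0)" for y
  proof -
    have "(w + z - x0) \<bullet> (y - x0) \<le> norm (w + (z - x0)) * norm (y - x0)"
      using norm_cauchy_schwarz[of "w + (z - x0)" "y - x0"] by (simp add: add_diff_eq)
    also have "\<dots> \<le> (norm w + d) * norm (y - x0)"
      using z norm_triangle_ineq[of w "z - x0"] by (intro mult_right_mono) auto
    finally show ?thesis .
  qed
  have ml: "ereal m \<le> f y" if "y \<in> cball x0 r" for y
  proof -
    have "\<bar>v0 \<bullet> (y - x0)\<bar> \<le> norm v0 * norm (y - x0)" by (rule Cauchy_Schwarz_ineq2)
    also have "\<dots> \<le> norm v0 * r"
      using that by (intro mult_left_mono) (auto simp: dist_norm norm_minus_commute)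
    finally have "ereal m \<le> ereal (c0 + v0 \<bullet> (y - x0))" by (simp add: m_def)
    with low[OF that] show ?thesis by (rule order_trans[rotated])
  qed
  have M0: "c0 \<le> M" using \<open>r > 0\<close> dpos by (simp add: M_def)
  have x0S: "(x0, c0) \<in> S" using f0 \<open>r > 0\<close> M0 by (auto simp: S_def epi_def m_def)
  have "compact S" unfolding S_def
    by (intro closed_Int_compact closed_epi \<open>lsc f\<close> compact_Times compact_cball compact_Icc)
  moreover have "continuous_on S g"
    unfolding g_def case_prod_unfold by (intro continuous_intros) auto
  ultimately obtain p where p: "p \<in> S" "\<And>q. q \<in> S \<Longrightarrow> g p \<le> g q"
    using continuous_attains_inf[of S g] x0S by blast
  obtain x a where xa: "p = (x, a)" by (cases p)
  have glob: "g (x, a) \<le> g (y, b)" if y: "y \<in> cball x0 r" and fb: "f y \<le> ereal b" for y b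
  proof (cases "b \<le> M")
    case True
    have "m \<le> b" using ml[OF y] fb by (meson ereal_less_eq(3) order_trans)
    then show ?thesis using p(2)[of "(y, b)"] True y fb by (auto simp: xa S_def epi_def)
  next
    case False
    have "(norm w + d) * norm (y - x0) \<le> (norm w + d) * r"
      using y dpos by (intro mult_left_mono) (auto simp: dist_norm norm_minus_commute)
    then have "g (x0, c0) - g (y, b) \<le> 0"
      using gdiff[of x0 c0 y b] slope[of y] False zero_le_power2[of "norm (y - x0)"]
      unfolding M_def by linarith
    with p(2)[OF x0S] show ?thesis by (simp add: xa)
  qed
  have x: "x \<in> cball x0 r" and "f x \<le> ereal a" using p(1) by (auto simp: xa S_def epi_def)
  then obtain c where fx: "f x = ereal c" using ml[OF x] by (cases "f x") auto
  \<comment> \<open>Over the fixed point \<open>x\<close> the objective increases with the height,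
    so the minimum lies on the graph.\<close>
  have ac: "a = c"
    using glob[OF x, of c] \<open>f x \<le> ereal a\<close> fx by (simp add: g_def)
  have *: "c - c0 - (w + z - x0) \<bullet> (x - x0) + (norm (x - x0))\<^sup>2 / 2 \<le> 0"
    using glob[of x0 c0] gdiff[of x0 c0 x c] f0 \<open>r > 0\<close> by (simp add: ac)
  have lowx: "c0 + v0 \<bullet> (x - x0) \<le> c" using low[OF x] by (simp add: fx)
  \<comment> \<open>Inserting the affine minorant leaves only the small vectors
    \<open>w - v0\<close> and \<open>z - x0\<close> on the right; Cauchy-Schwarz and division by
    \<open>norm (x - x0)\<close> lead to the bound \<open>4 * d\<close>.\<close>
  have "(norm (x - x0))\<^sup>2 / 2 \<le> ((w - v0) + (z - x0)) \<bullet> (x - x0)"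
    using * lowx by (simp add: inner_left_distrib inner_diff_left)
  also have "\<dots> \<le> norm ((w - v0) + (z - x0)) * norm (x - x0)" by (rule norm_cauchy_schwarz)
  also have "\<dots> \<le> (norm (w - v0) + norm (z - x0)) * norm (x - x0)"
    by (intro mult_right_mono norm_triangle_ineq norm_ge_zero)
  finally have "norm (x - x0) * norm (x - x0) \<le> (2 * (norm (w - v0) + norm (z - x0))) * norm (x - x0)"
    by (simp add: power2_eq_square algebra_simps)
  then have "norm (x - x0) \<le> 2 * (norm (w - v0) + norm (z - x0))"
    by (cases "x = x0") (simp, simp only: mult_le_cancel_right_pos zero_less_norm_iff right_minus_eq not_False_eq_True)
  with w z have nx: "norm (x - x0) < 4 * d" by simp
  have "c \<le> c0 + (norm w + d) * norm (x - x0)"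
    using * slope[of x] zero_le_power2[of "norm (x - x0)"] by linarith
  also have "\<dots> \<le> c0 + (norm w + d) * (4 * d)"
    using nx dpos by (intro add_left_mono mult_left_mono) auto
  finally have cle: "c \<le> c0 + (norm w + d) * (4 * d)" .
  have "w + z - x \<in> regular_subdifferential f x"
    unfolding regular_subdifferential_iff[of f, OF fx]
  proof (intro allI impI)
    fix e :: real assume e: "e > 0"
    have "x \<in> ball x0 r" using nx d by (simp add: dist_norm norm_minus_commute)
    \<comment> \<open>Within radius \<open>2 * e\<close> the quadratic remainder is at most
      \<open>e * norm (y - x)\<close>.\<close>
    then have "\<forall>\<^sub>F y in nhds x. y \<in> ball x0 r \<inter> ball x (2 * e)"
      using e by (intro eventually_nhds_in_open) auto
    then show "\<forall>\<^sub>F y in nhds x. ereal (c + (w + z - x) \<bullet> (y - x) - e * norm (y - x)) \<le> f y"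
    proof eventually_elim
      case (elim y)
      then have y: "y \<in> cball x0 r" and n: "norm (y - x) \<le> 2 * e"
        by (auto simp: dist_norm norm_minus_commute)
      show ?case
      proof (cases "f y")
        case (real b)
        have "(norm (y - x))\<^sup>2 / 2 \<le> e * norm (y - x)"
          using mult_right_mono[OF n, of "norm (y - x)"] by (simp add: power2_eq_square)
        then show ?thesis
          using glob[OF y, of b] gdiff[of x a y b] real by (simp add: ac)
      qed (use ml[OF y] in auto)
    qed
  qed
  with fx nx cle show ?thesis by (rule that)
qed

section \<open>The convex minorant as a supremum of affine functions\<close>

text \<open>The supremum \<open>fh\<close> serves as the convex function of the definition. The
  graph identity is shown on balls of a radius \<open>d\<close> smaller than \<open>r\<close>, so
  that for \<open>(z, w)\<close> in these balls the auxiliary point \<open>x\<close> and its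
  subgradient \<open>w + z - x\<close> still belong to \<open>G\<close>.\<close>

lemma variationally_convex_funI:
  fixes f :: "'a::euclidean_space \<Rightarrow> ereal"
  assumes "proper f" "lsc f" and f0: "f x0 = ereal c0" and v0: "v0 \<in> limiting_subdifferential f x0"
    and "r > 0" "\<epsilon> > 0"
    and H: "\<And>x v c y. x \<in> ball x0 r \<Longrightarrow> v \<in> ball v0 r \<Longrightarrow> v \<in> limiting_subdifferential f x \<Longrightarrow>
      f x = ereal c \<Longrightarrow> c < c0 + \<epsilon> \<Longrightarrow> y \<in> ball x0 r \<Longrightarrow> ereal (c + v \<bullet> (y - x)) \<le> f y"
  shows "variationally_convex_fun f x0 v0"
proof -
  define G where "G = {(x, v, c). x \<in> ball x0 r \<and> v \<in> ball v0 r \<and> v \<in> limiting_subdifferential f x \<and>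
    f x = ereal c \<and> c < c0 + \<epsilon>}"
  define fh where "fh = (\<lambda>y. SUP (x, v, c) \<in> G. ereal (c + v \<bullet> (y - x)))"
  \<comment> \<open>This triple keeps \<open>fh\<close> off \<open>-\<infinity>\<close> and supplies
    the affine minorant at \<open>x0\<close> for \<open>perturbed_minimizer\<close>.\<close>
  have G0: "(x0, v0, c0) \<in> G" using v0 f0 \<open>r > 0\<close> \<open>\<epsilon> > 0\<close> by (simp add: G_def)
  have lo: "ereal (c + v \<bullet> (y - x)) \<le> fh y" if "(x, v, c) \<in> G" for x v c y
    unfolding fh_def by (rule SUP_upper2[OF that]) simp
  have up: "fh y \<le> f y" if "y \<in> ball x0 r" for y
    unfolding fh_def by (rule SUP_least) (use H that in \<open>auto simp: G_def\<close>)
  have eq: "fh x = ereal c" if "(x, v, c) \<in> G" for x v c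
    using lo[OF that, of x] up[of x] that by (auto simp: G_def intro!: antisym)
  have notM: "fh y \<noteq> -\<infinity>" for y using lo[OF G0, of y] by auto
  have sub: "v \<in> limiting_subdifferential fh x" if "(x, v, c) \<in> G" for x v c
    using global_subgradient_regular[of fh, OF eq[OF that] lo[OF that]] regular_subset_limiting by blast
  \<comment> \<open>Each affine minorant contributes a half-space with normal
    \<open>(v, -1)\<close>, so the epigraph is convex as an intersection.\<close>
  have "epi fh = (\<Inter>(x, v, c) \<in> G. {p. (v, -1) \<bullet> p \<le> v \<bullet> x - c})"
    by (auto simp: epi_def fh_def SUP_le_iff inner_diff_right algebra_simps)
  then have cvx: "convex_fun fh"
    by (auto simp: convex_fun_def intro!: convex_INT convex_halfspace_le)
  have lsc: "lsc fh"
    unfolding lsc_def le_Liminf_iff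
  proof (intro allI impI)
    fix y b assume "b < fh y"
    then obtain x v c where g: "(x, v, c) \<in> G" "b < ereal (c + v \<bullet> (y - x))"
      by (auto simp: fh_def less_SUP_iff)
    have "((\<lambda>y. ereal (c + v \<bullet> (y - x))) \<longlongrightarrow> ereal (c + v \<bullet> (y - x))) (at y)"
      by (intro tendsto_ereal tendsto_add tendsto_inner tendsto_diff tendsto_const tendsto_ident_at)
    from order_tendstoD(1)[OF this g(2)] show "\<forall>\<^sub>F y in at y. b < fh y"
      by eventually_elim (use lo[OF g(1)] less_le_trans in blast)
  qed
  \<comment> \<open>With \<open>8 * d \<le> r\<close>, the point \<open>x\<close> stays within
    \<open>4 * d\<close> of \<open>x0\<close> and \<open>w + z - x\<close> within
    \<open>6 * d\<close> of \<open>v0\<close>. The last bound gives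
    \<open>(norm w + d) * (4 * d) \<le> \<epsilon> / 2\<close>, hence
    \<open>c < c0 + \<epsilon>\<close>.\<close>
  define d where "d = min (r / 8) (min 1 (\<epsilon> / (8 * (norm v0 + 2))))"
  have n2: "norm v0 + 2 > 0" by (simp add: add_nonneg_pos)
  have "d \<le> r / 8" "d \<le> 1" unfolding d_def by linarith+
  moreover have "d > 0" using \<open>r > 0\<close> \<open>\<epsilon> > 0\<close> n2 by (simp add: d_def)
  ultimately have d: "d > 0" "8 * d \<le> r" "d \<le> 1" by simp_all
  have "d \<le> \<epsilon> / (8 * (norm v0 + 2))" by (simp add: d_def)
  then have dn: "(norm v0 + 2) * (4 * d) \<le> \<epsilon> / 2" using n2 by (simp add: field_simps)
  have GI: "(x, v, c) \<in> G" if "x \<in> ball x0 d" "v \<in> ball v0 d" "v \<in> limiting_subdifferential f x"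
    "f x = ereal c" "c < c0 + \<epsilon>" for x v c
    using that d by (auto simp: G_def)
  have conv: "\<exists>c. (z, w, c) \<in> G" if z: "z \<in> ball x0 d" and w: "w \<in> ball v0 d"
    and sg: "w \<in> limiting_subdifferential fh z" for z w
  proof -
    have "norm (w - v0) < d" "norm (z - x0) < d" using z w by (auto simp: dist_norm norm_minus_commute)
    moreover have "ereal (c0 + v0 \<bullet> (y - x0)) \<le> f y" if "y \<in> cball x0 (r / 2)" for y
      using lo[OF G0, of y] up[of y] that \<open>r > 0\<close> by (auto intro: order_trans)
    ultimately obtain x c where x: "f x = ereal c" "norm (x - x0) < 4 * d"
      "c \<le> c0 + (norm w + d) * (4 * d)" "w + z - x \<in> regular_subdifferential f x"
      using perturbed_minimizer[OF \<open>lsc f\<close> f0, of "r / 2" v0 w d z] \<open>r > 0\<close> d by auto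
    have "norm w \<le> norm v0 + d"
      using \<open>norm (w - v0) < d\<close> norm_triangle_sub[of w v0] by simp
    then have "(norm w + d) * (4 * d) \<le> (norm v0 + 2) * (4 * d)"
      using d by (intro mult_right_mono) auto
    with dn x(3) \<open>\<epsilon> > 0\<close> have c: "c < c0 + \<epsilon>" by simp
    have "norm (w + z - x - v0) \<le> norm (w - v0) + norm (z - x0) + norm (x - x0)"
      using norm_triangle_ineq[of "w - v0" "z - x"] norm_triangle_ineq4[of "z - x0" "x - x0"]
      by (simp add: algebra_simps)
    also have "\<dots> < r" using x(2) \<open>norm (w - v0) < d\<close> \<open>norm (z - x0) < d\<close> d by simp
    finally have G: "(x, w + z - x, c) \<in> G"
      using x c d regular_subset_limiting[of f x]
      by (auto simp: G_def dist_norm norm_minus_commute)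
    obtain b where fz: "fh z = ereal b"
      using sg notM[of z] by (cases "fh z") (auto simp: limiting_subdifferential_def effective_domain_def)
    \<comment> \<open>Monotonicity: the subgradient inequalities of \<open>fh\<close> for
      \<open>w + z - x\<close> at \<open>x\<close> and for \<open>w\<close> at \<open>z\<close> add
      up to \<open>(z - x) \<bullet> (z - x) \<le> 0\<close>.\<close>
    have "c + (w + z - x) \<bullet> (z - x) \<le> b" using lo[OF G, of z] by (simp add: fz)
    moreover have "b + w \<bullet> (x - z) \<le> c"
      using convex_limiting_subgradient[OF cvx notM fz sg, of x] by (simp add: eq[OF G])
    ultimately have "(z - x) \<bullet> (z - x) \<le> 0" by (simp add: algebra_simps)
    then have "z = x" by (metis inner_gt_zero_iff not_le right_minus_eq)
    with G show ?thesis by auto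
  qed
  let ?U = "ball x0 d" and ?V = "ball v0 d"
  have "({x \<in> ?U. f x < f x0 + ereal \<epsilon>} \<times> ?V) \<inter> gph (limiting_subdifferential f)
          = (?U \<times> ?V) \<inter> gph (limiting_subdifferential fh)" (is "?L = ?R")
  proof (intro equalityI subrelI)
    fix x v assume xv: "(x, v) \<in> ?L"
    then obtain c where c: "f x = ereal c" "c < c0 + \<epsilon>"
      using \<open>proper f\<close> f0 by (cases "f x") (auto simp: proper_def)
    with xv have "(x, v, c) \<in> G" by (intro GI) (auto simp: gph_def)
    from sub[OF this] xv show "(x, v) \<in> ?R" by (auto simp: gph_def)
  next
    fix x v assume xv: "(x, v) \<in> ?R"
    with conv[of x v] obtain c where "(x, v, c) \<in> G" by (auto simp: gph_def)
    with xv f0 show "(x, v) \<in> ?L" by (auto simp: gph_def G_def)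
  qed
  moreover have "\<forall>(x, v) \<in> (?U \<times> ?V) \<inter> gph (limiting_subdifferential fh). f x = fh x"
  proof safe
    fix x v assume "x \<in> ?U" "v \<in> ?V" "(x, v) \<in> gph (limiting_subdifferential fh)"
    then obtain c where "(x, v, c) \<in> G" using conv[of x v] by (auto simp: gph_def)
    with eq[OF this] show "f x = fh x" by (simp add: G_def)
  qed
  moreover have "\<forall>x\<in>?U. fh x \<le> f x" using up d by auto
  ultimately show ?thesis
    unfolding variationally_convex_fun_def
    using assms(1,2) f0 v0 \<open>\<epsilon> > 0\<close> cvx lsc d(1)
    by (intro conjI exI[of _ ?U] exI[of _ ?V] exI[of _ fh] exI[of _ \<epsilon>])
       (auto simp: effective_domain_def)
qed

section \<open>The two implications\<close>

text \<open>The normal \<open>(v, -1)\<close> at \<open>(x, f x)\<close> gives the affine minorant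
  at each \<open>y\<close> whose graph point lies in the neighbourhood \<open>U\<close>. At the
  other \<open>y\<close> near \<open>x0\<close>, \<open>f y\<close> is so large that it exceeds the
  affine function anyway.\<close>

lemma variationally_convex_set_epiD:
  fixes f :: "'a::euclidean_space \<Rightarrow> ereal"
  assumes "proper f" "lsc f" and f0: "f x0 = ereal c0" and v0: "v0 \<in> limiting_subdifferential f x0"
    and vc: "variationally_convex_set (epi f) (x0, c0) (v0, -1)"
  shows "variationally_convex_fun f x0 v0"
proof -
  obtain U V where U: "open U" "(x0, c0) \<in> U" and V: "open V" "(v0, -1) \<in> V"
    and H: "\<And>p q p'. q \<in> limiting_normal_cone (epi f) p \<Longrightarrow> p \<in> U \<Longrightarrow> q \<in> V \<Longrightarrow> p' \<in> epi f \<Longrightarrow> p' \<in> U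
      \<Longrightarrow> q \<bullet> (p' - p) \<le> 0"
  proof -
    from vc obtain U V where "open U" "(x0, c0) \<in> U" "open V" "(v0, -1) \<in> V"
      and *: "\<forall>(x, v) \<in> gph (limiting_normal_cone (epi f)) \<inter> (U \<times> V). \<forall>x' \<in> epi f \<inter> U. v \<bullet> (x' - x) \<le> 0"
      unfolding variationally_convex_set_def by (elim conjE exE)
    moreover have "q \<bullet> (p' - p) \<le> 0"
      if "q \<in> limiting_normal_cone (epi f) p" "p \<in> U" "q \<in> V" "p' \<in> epi f" "p' \<in> U" for p q p'
      using bspec[OF *, of "(p, q)"] that by (simp add: gph_def)
    ultimately show ?thesis using that[of U V] by blast
  qed
  obtain A I where A: "open A" "open I" "(x0, c0) \<in> A \<times> I" "A \<times> I \<subseteq> U"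
    using open_prod_elim[OF U] by metis
  obtain B J where B: "open B" "open J" "(v0, -1) \<in> B \<times> J" "B \<times> J \<subseteq> V"
    using open_prod_elim[OF V] by metis
  obtain e where e: "e > 0" "ball c0 e \<subseteq> I" using A by (auto simp: open_contains_ball)
  \<comment> \<open>Lower semicontinuity bounds the heights from below, so that over nearby points
    every value of \<open>f\<close> below \<open>c0 + e\<close> lies in \<open>I\<close>.\<close>
  have "\<forall>\<^sub>F y in nhds x0. y \<in> A" "\<forall>\<^sub>F y in nhds x0. ereal (c0 - e) < f y"
    using A e f0 by (auto intro!: eventually_nhds_in_open lsc_eventually[OF \<open>lsc f\<close>])
  then have "\<forall>\<^sub>F y in nhds x0. y \<in> A \<and> ereal (c0 - e) < f y" by (rule eventually_conj)
  then obtain r1 where r1: "r1 > 0" "\<And>y. y \<in> ball x0 r1 \<Longrightarrow> y \<in> A \<and> ereal (c0 - e) < f y"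
    by (auto simp: eventually_nhds_metric dist_commute)
  obtain r2 where r2: "r2 > 0" "ball v0 r2 \<subseteq> B" using B by (auto simp: open_contains_ball)
  \<comment> \<open>The last bound makes \<open>v \<bullet> (y - x)\<close> at most
    \<open>e / 2\<close>; together with \<open>c < c0 + e / 2\<close> it keeps the affine function
    at or below \<open>c0 + e\<close>.\<close>
  define r where "r = min (min r1 r2) (min 1 (e / (4 * (norm v0 + 1))))"
  have n1: "norm v0 + 1 > 0" by (simp add: add_nonneg_pos)
  have r: "r > 0" "r \<le> r1" "r \<le> r2" "r \<le> 1" "r \<le> e / (4 * (norm v0 + 1))"
    using r1 r2 e n1 by (simp_all add: r_def)
  have re: "(norm v0 + 1) * (2 * r) \<le> e / 2" using r(5) n1 by (simp add: field_simps)
  show ?thesis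
  proof (rule variationally_convex_funI[OF \<open>proper f\<close> \<open>lsc f\<close> f0 v0 r(1), of "e / 2"])
    show "e / 2 > 0" using e by simp
    fix x v c y
    assume x: "x \<in> ball x0 r" and v: "v \<in> ball v0 r" and sg: "v \<in> limiting_subdifferential f x"
      and fx: "f x = ereal c" and c: "c < c0 + e / 2" and y: "y \<in> ball x0 r"
    have xA: "x \<in> A" "ereal (c0 - e) < f x" and yA: "y \<in> A" "ereal (c0 - e) < f y"
      using r1(2) x y r by auto
    have "(x, c) \<in> U" using xA c e A fx by (auto simp: dist_real_def subset_iff)
    moreover have "(v, -1) \<in> V" using v r r2 B by (auto simp: subset_iff)
    moreover note limiting_normal_epi[OF \<open>proper f\<close> fx sg]
    ultimately have ineq: "v \<bullet> (y - x) \<le> b - c" if "f y \<le> ereal b" "(y, b) \<in> U" for b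
      using H[of "(v, -1)" "(x, c)" "(y, b)"] that by (simp add: epi_def)
    show "ereal (c + v \<bullet> (y - x)) \<le> f y"
    proof (cases "f y < ereal (c0 + e)")
      case True
      then obtain b where b: "f y = ereal b" using yA by (cases "f y") auto
      have "(y, b) \<in> U" using yA True e A b by (auto simp: dist_real_def subset_iff)
      then show ?thesis using ineq[of b] b by simp
    next
      case False
      have "norm v \<le> norm v0 + 1"
        using v r norm_triangle_sub[of v v0] by (simp add: dist_norm norm_minus_commute)
      moreover have "norm (y - x) \<le> 2 * r"
        using x y dist_triangle3[of y x x0] by (simp add: dist_norm[symmetric])
      ultimately have "norm v * norm (y - x) \<le> (norm v0 + 1) * (2 * r)"
        by (intro mult_mono) auto
      then have "ereal (c + v \<bullet> (y - x)) \<le> ereal (c0 + e)"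
        using norm_cauchy_schwarz[of v "y - x"] re c by simp
      with False show ?thesis by (metis not_le order_trans linear)
    qed
  qed
qed

text \<open>The subgradient inequality of \<open>fh\<close> passes to \<open>f\<close> because
  \<open>fh\<close> lies below \<open>f\<close> on \<open>U\<close> and agrees with it at the base
  point. Rescaling transfers it to regular normals of the epigraph, and a limit to all normals near
  \<open>(v0, -1)\<close>.\<close>

lemma variationally_convex_set_epiI:
  fixes f :: "'a::euclidean_space \<Rightarrow> ereal"
  assumes f0: "f x0 = ereal c0" and vc: "variationally_convex_fun f x0 v0"
  shows "variationally_convex_set (epi f) (x0, c0) (v0, -1)"
proof -
  obtain U V fh \<epsilon> where P: "proper f" "lsc f" "v0 \<in> limiting_subdifferential f x0"
    and "\<epsilon> > 0" and U: "open U" "convex U" "x0 \<in> U" and V: "open V" "v0 \<in> V"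
    and fh: "convex_fun fh" "lsc fh" "\<And>x. x \<in> U \<Longrightarrow> fh x \<le> f x"
    and gr: "({x \<in> U. f x < f x0 + ereal \<epsilon>} \<times> V) \<inter> gph (limiting_subdifferential f)
          = (U \<times> V) \<inter> gph (limiting_subdifferential fh)"
    and eq: "\<And>x v. (x, v) \<in> (U \<times> V) \<inter> gph (limiting_subdifferential fh) \<Longrightarrow> f x = fh x"
  proof -
    from vc obtain U V fh \<epsilon> where *: "proper f" "lsc f" "v0 \<in> limiting_subdifferential f x0"
      "\<epsilon> > 0" "open U" "convex U" "x0 \<in> U" "open V" "v0 \<in> V"
      "convex_fun fh" "lsc fh" "\<forall>x\<in>U. fh x \<le> f x"
      "({x \<in> U. f x < f x0 + ereal \<epsilon>} \<times> V) \<inter> gph (limiting_subdifferential f)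
          = (U \<times> V) \<inter> gph (limiting_subdifferential fh)"
      "\<forall>(x, v) \<in> (U \<times> V) \<inter> gph (limiting_subdifferential fh). f x = fh x"
      unfolding variationally_convex_fun_def by (elim conjE exE)
    show ?thesis
      by (rule that[OF *(1-11) bspec[OF *(12)] *(13)]) (use *(14) in auto)
  qed
  have sub: "fh x = f x \<and> v \<in> limiting_subdifferential fh x"
    if "x \<in> U" "v \<in> V" "f x < ereal (c0 + \<epsilon>)" "v \<in> limiting_subdifferential f x" for x v
  proof -
    have "(x, v) \<in> (U \<times> V) \<inter> gph (limiting_subdifferential fh)"
      using that f0 unfolding gr[symmetric] by (auto simp: gph_def)
    with eq[OF this] show ?thesis by (simp add: gph_def)
  qed
  \<comment> \<open>The reference pair lies in the common graph, so \<open>fh\<close> is finite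
    somewhere and hence nowhere \<open>-\<infinity>\<close>.\<close>
  have "fh x0 = ereal c0" using sub[of x0 v0] U V P f0 \<open>\<epsilon> > 0\<close> by simp
  then have notM: "fh y \<noteq> -\<infinity>" for y using convex_lsc_not_MInf[OF fh(1,2)] by blast
  have minor: "ereal (c + v \<bullet> (y - x)) \<le> f y"
    if "x \<in> U" "v \<in> V" "f x = ereal c" "c < c0 + \<epsilon>" "v \<in> regular_subdifferential f x" "y \<in> U" for x v c y
  proof -
    have "fh x = ereal c" "v \<in> limiting_subdifferential fh x"
      using sub[of x v] that regular_subset_limiting[of f x] by auto
    from convex_limiting_subgradient[OF fh(1) notM this] fh(3)[OF \<open>y \<in> U\<close>] show ?thesis
      by (rule order_trans)
  qed
  \<comment> \<open>Bounding the heights by \<open>c0 + \<epsilon>\<close> enforces the condition on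
    \<open>f x\<close> in the localized graph.\<close>
  define W where "W = U \<times> {..<c0 + \<epsilon>}"
  have W: "open W" "convex W" "(x0, c0) \<in> W"
    using U \<open>\<epsilon> > 0\<close> by (auto simp: W_def intro!: open_Times convex_Times)
  \<comment> \<open>Scaling the last component to \<open>-1\<close> is continuous where it is
    negative and maps \<open>(v0, -1)\<close> to \<open>v0\<close>, so normals near
    \<open>(v0, -1)\<close> rescale into \<open>V\<close>.\<close>
  have "open ((UNIV \<times> {..<0::real}) \<inter> (\<lambda>q. (1 / - snd q) *\<^sub>R fst q) -` V)"
    using V(1) by (intro continuous_open_preimage continuous_intros open_Times) auto
  moreover have "(v0, -1) \<in> (UNIV \<times> {..<0::real}) \<inter> (\<lambda>q. (1 / - snd q) *\<^sub>R fst q) -` V"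
    using V by simp
  ultimately obtain \<delta> where \<delta>: "\<delta> > 0"
    "ball (v0, -1::real) \<delta> \<subseteq> (UNIV \<times> {..<0}) \<inter> (\<lambda>q. (1 / - snd q) *\<^sub>R fst q) -` V"
    by (meson open_contains_ball)
  let ?B = "ball (v0, -1::real) \<delta>"
  have reg: "q \<bullet> (p' - p) \<le> 0"
    if q: "q \<in> regular_normal_cone (epi f) p" and pW: "p \<in> W" and qB: "q \<in> ?B"
      and p': "p' \<in> epi f" "p' \<in> W" for p q p'
  proof -
    obtain x a v m y b where eqs: "p = (x, a)" "q = (v, m)" "p' = (y, b)" by (metis surj_pair)
    have m: "m < 0" and vV: "(1 / - m) *\<^sub>R v \<in> V" using \<delta>(2) qB by (auto simp: eqs)
    note n = regular_normal_epi_cases[OF q[unfolded eqs] m]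
    have "ereal (a + ((1 / - m) *\<^sub>R v) \<bullet> (y - x)) \<le> f y"
      using minor[OF _ vV n(1) _ n(2)] pW p' by (auto simp: eqs W_def)
    also have "f y \<le> ereal b" using p' by (simp add: eqs epi_def)
    finally have "a + (1 / - m) * (v \<bullet> (y - x)) \<le> b" by simp
    then have "v \<bullet> (y - x) \<le> (- m) * (b - a)" using m by (simp add: field_simps)
    then show ?thesis by (simp add: eqs algebra_simps)
  qed
  \<comment> \<open>The passage to the limit is taken on the inequality: a limiting normal with negative last component
    may be based at \<open>(x, a)\<close> with \<open>f x < a\<close>, where it corresponds to no subgradient of \<open>f\<close>.\<close>
  have lim: "q \<bullet> (p' - p) \<le> 0"
    if q: "q \<in> limiting_normal_cone (epi f) p" and pW: "p \<in> W" and qB: "q \<in> ?B"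
      and p': "p' \<in> epi f" "p' \<in> W" for p q p'
  proof -
    obtain ps qs where s: "\<And>k::nat. qs k \<in> regular_normal_cone (epi f) (ps k)" "ps \<longlonglongrightarrow> p" "qs \<longlonglongrightarrow> q"
      using q by (auto simp: limiting_normal_cone_iff)
    have "(\<lambda>k. qs k \<bullet> (p' - ps k)) \<longlonglongrightarrow> q \<bullet> (p' - p)"
      by (intro tendsto_intros s)
    moreover have "\<forall>\<^sub>F k in sequentially. qs k \<bullet> (p' - ps k) \<le> 0"
      using topological_tendstoD[OF s(2) W(1) pW] topological_tendstoD[OF s(3) open_ball qB]
      by eventually_elim (use reg s(1) p' in blast)
    ultimately show ?thesis by (rule tendsto_upperbound) simp
  qed
  show ?thesis
    unfolding variationally_convex_set_def
  proof (intro conjI)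
    show "(x0, c0) \<in> epi f" by (simp add: epi_def f0)
    then show "epi f \<noteq> {}" by blast
    show "closed (epi f)" by (rule closed_epi[OF P(2)])
    show "(v0, -1) \<in> limiting_normal_cone (epi f) (x0, c0)" by (rule limiting_normal_epi[OF P(1) f0 P(3)])
    show "\<exists>U V. open U \<and> convex U \<and> (x0, c0) \<in> U \<and> open V \<and> convex V \<and> (v0, -1) \<in> V \<and>
        (\<forall>(x, v) \<in> gph (limiting_normal_cone (epi f)) \<inter> (U \<times> V). \<forall>x' \<in> epi f \<inter> U. v \<bullet> (x' - x) \<le> 0)"
      using W \<delta>(1) lim by (intro exI[of _ W] exI[of _ ?B]) (auto simp: gph_def)
  qed
qed

theorem theorem3p9:
  fixes f :: "real ^ 'n \<Rightarrow> ereal" and xbar vbar :: "real ^ 'n"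
  assumes "proper f" and "lsc f"
    and "xbar \<in> effective_domain f"
    and "vbar \<in> limiting_subdifferential f xbar"
  shows "variationally_convex_fun f xbar vbar \<longleftrightarrow>
    variationally_convex_set (epi f) (xbar, real_of_ereal (f xbar)) (vbar, -1)"
proof -
  \<comment> \<open>\<open>f xbar\<close> is finite, so \<open>real_of_ereal\<close> returns its
    value and not the default \<open>0\<close>.\<close>
  have "f xbar = ereal (real_of_ereal (f xbar))"
    using assms(1,3) by (cases "f xbar") (auto simp: proper_def effective_domain_def)
  then show ?thesis
    using variationally_convex_set_epiI variationally_convex_set_epiD assms by blast
qed

end
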